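(* Let $G$ be a locally bipartite graph. If $\delta(G) > \frac{8}{15} |G|$, then $G$ is either $3$-colourable or contains $H_0$ or $T_0$ as a subgraph. If $\delta(G) > \frac{7}{13}|G|$, then $G$ is either $3$-colourable or contains $H_0$ as a subgraph.
   Context: Graphs are finite and simple; $|G|$ is the number of vertices, $\delta(G)$ the minimum degree. A graph is locally bipartite if the neighbourhood of every vertex induces a bipartite graph. $H_0$ (the Moser spindle) has vertices $a_0,\dots,a_6$ and edges $a_ia_{i+1}$ ($i=0,\dots,6$, indices mod 7) together with $a_0a_2$, $a_0a_5$, $a_1a_3$, $a_4a_6$. $T_0$ has vertices $v_0,\dots,v_6,u_1,u_6,t$ with edges $v_iv_{i+1}$ ($i$ mod 7), $u_1v_i$ for all $i\neq 1$, $u_6v_i$ for all $i \neq 6$, and $tv_0$, $tu_1$, $tu_6$ (and no other edges; in particular $u_1u_6$ is not an edge). *)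

theory Defs
  imports Complex_Main "Graph_Theory.Graph_Theory"
begin

text \<open>
  A finite simple graph is an element of the locale \<^locale>\<open>graph\<close>: a finite symmetric digraph
  without loops or parallel arcs. An undirected edge $uv$ is the pair of opposite arcs between
  $u$ and $v$, so that the degree of a vertex is its out-degree.
\<close>

text \<open>Unspecified for the graph without vertices.\<close>

definition min_degree :: "('a, 'b) pre_digraph \<Rightarrow> nat" where
  "min_degree G = Min (out_degree G ` verts G)"

definition neighbourhood :: "('a, 'b) pre_digraph \<Rightarrow> 'a \<Rightarrow> 'a set" where
  "neighbourhood G v = {u \<in> verts G. v \<rightarrow>\<^bsub>G\<^esub> u}"

definition colourable :: "nat \<Rightarrow> ('a, 'b) pre_digraph \<Rightarrow> bool" where
  "colourable k G \<longleftrightarrow>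
    (\<exists>c :: 'a \<Rightarrow> nat. (\<forall>v \<in> verts G. c v < k) \<and> (\<forall>u v. u \<rightarrow>\<^bsub>G\<^esub> v \<longrightarrow> c u \<noteq> c v))"

definition bipartite :: "('a, 'b) pre_digraph \<Rightarrow> bool" where
  "bipartite G \<longleftrightarrow>
    (\<exists>A B. A \<union> B = verts G \<and> A \<inter> B = {} \<and>
      (\<forall>u v. u \<rightarrow>\<^bsub>G\<^esub> v \<longrightarrow> (u \<in> A \<and> v \<in> B) \<or> (u \<in> B \<and> v \<in> A)))"

definition locally_bipartite :: "('a, 'b) pre_digraph \<Rightarrow> bool" where
  "locally_bipartite G \<longleftrightarrow> (\<forall>v \<in> verts G. bipartite (G \<restriction> neighbourhood G v))"

text \<open>Not necessarily as an induced subgraph.\<close>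

definition contains_subgraph ::
    "('a, 'b) pre_digraph \<Rightarrow> ('c, 'd) pre_digraph \<Rightarrow> bool" where
  "contains_subgraph G H \<longleftrightarrow> (\<exists>H'. subgraph H' G \<and> digraph_iso H H')"

text \<open>The Moser spindle; the vertex $a_i$ is the number $i$.\<close>

definition H0 :: "(nat, nat \<times> nat) pre_digraph" where
  "H0 = with_proj
    \<lparr> pverts = {0..6},
      parcs = ({(i, (i + 1) mod 7) | i. i \<le> 6} \<union> {(0, 2), (0, 5), (1, 3), (4, 6)})\<^sup>s \<rparr>"

datatype T0_vertex = T0_v nat | T0_u1 | T0_u6 | T0_t

definition T0 :: "(T0_vertex, T0_vertex \<times> T0_vertex) pre_digraph" where
  "T0 = with_proj
    \<lparr> pverts = T0_v ` {0..6} \<union> {T0_u1, T0_u6, T0_t},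
      parcs = ({(T0_v i, T0_v ((i + 1) mod 7)) | i. i \<le> 6}
        \<union> {(T0_u1, T0_v i) | i. i \<le> 6 \<and> i \<noteq> 1}
        \<union> {(T0_u6, T0_v i) | i. i \<le> 6 \<and> i \<noteq> 6}
        \<union> {(T0_t, T0_v 0), (T0_t, T0_u1), (T0_t, T0_u6)})\<^sup>s \<rparr>"

end

theory Submission
  imports Defs
begin

text \<open>
  Let $G$ be locally bipartite with $\delta(G) > \frac{8}{15}|G|$ and without $H_0$. Two diamonds with
  a common end and adjacent other ends form a spindle, since in any degenerate case there is a
  $K_4$ or a 5-wheel. Choose an edge $xy$ whose common neighbourhood $Z$ is as large as possible,
  and let $J$ be the set of vertices without neighbours in $Z$. Two adjacent vertices of $J$ would
  have more than $|Z|$ common neighbours, so $J$ is independent, and it suffices to make $G - J$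
  bipartite.

  Every step from here on is a weighted degree count: if vertices of total weight $s$ are such that
  no vertex sees a weight of more than $m$ among them, then $s \delta \le m |G|$. The weights are optimal
  solutions of the corresponding linear programs. Such counts show that $G - J$ has no triangle, that a
  shortest odd cycle $C$ of $G - J$ has length at most 7 (a vertex off $J$ has at most two neighbours
  on $C$ and a vertex of $J$ misses at least one vertex of $C$), and that the length is not 5. If $C$ has
  length 7, some two vertices of $J$ each miss exactly one vertex of $C$, and these two vertices are at
  distance 2 on $C$; a further count gives the vertex $t$ that completes a $T_0$. The two
  7-wheels with a missing spoke already force $\delta(G) \le \frac{7}{13}|G|$.
\<close>

section \<open>Closed walks\<close>

text \<open>Encoded as an \<open>m\<close>-periodic sequence on all naturals: rotating is a shift of
  the argument, and an arc running past the period needs no modular index.\<close>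

definition closed_walk :: "('a \<Rightarrow> 'a \<Rightarrow> bool) \<Rightarrow> nat \<Rightarrow> (nat \<Rightarrow> 'a) \<Rightarrow> bool" where
  "closed_walk R m c \<longleftrightarrow> (\<forall>i. R (c i) (c (Suc i))) \<and> (\<forall>i. c (i + m) = c i)"

lemma closed_walk_rotate: "closed_walk R m c \<Longrightarrow> closed_walk R m (\<lambda>i. c (i + s))"
  unfolding closed_walk_def by (metis add.commute add.left_commute add_Suc)

lemma closed_walk_relpowp: "closed_walk R m c \<Longrightarrow> (R ^^ k) (c i) (c (i + k))"
  by (induction k) (auto simp: closed_walk_def)

lemma closed_walk_mod: "closed_walk R m c \<Longrightarrow> c (i mod m) = c i"
proof -
  assume c: "closed_walk R m c"
  have "c (j + k * m) = c j" for j k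
  proof (induction k)
    case (Suc k)
    have "c (j + Suc k * m) = c ((j + k * m) + m)"
      by (simp add: algebra_simps)
    then show ?case
      using Suc c unfolding closed_walk_def by simp
  qed simp
  from this[of "i mod m" "i div m"] show ?thesis
    by simp
qed

lemma relpowp_closed_walk:
  assumes "(R ^^ m) v v" "m > 0"
  shows "\<exists>c. closed_walk R m c"
proof -
  obtain f where f: "f 0 = v" "f m = v" "\<And>i. i < m \<Longrightarrow> R (f i) (f (Suc i))"
    using assms(1) unfolding relpowp_fun_conv by auto
  have "R (f (i mod m)) (f (Suc i mod m))" for i
    using f(1,2) f(3)[of "i mod m"] assms(2) by (auto simp: mod_Suc)
  then have "closed_walk R m (\<lambda>i. f (i mod m))"
    by (simp add: closed_walk_def)
  then show ?thesis
    by blast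
qed

lemma relpowp_sym:
  assumes "symp R" "(R ^^ n) u v"
  shows "(R ^^ n) v u"
  using assms(2)
proof (induction n arbitrary: v)
  case (Suc n)
  then obtain w where "(R ^^ n) u w" "R w v"
    by auto
  then have "R v w" "(R ^^ n) w u"
    using Suc.IH assms(1) by (auto dest: sympD)
  then show ?case
    by (rule relpowp_Suc_I2)
qed simp

text \<open>Each component gets a root, and a vertex is coloured by the parity of its walks to the
  root. Two such walks of different parity would close up to an odd closed walk.\<close>

lemma two_colouring_if_no_odd_closed_walk:
  assumes "symp R" and no_odd: "\<And>n v. odd n \<Longrightarrow> \<not> (R ^^ n) v v"
  shows "\<exists>f :: 'a \<Rightarrow> bool. \<forall>u v. R u v \<longrightarrow> f u \<noteq> f v"
proof -
  define r where "r v = (SOME u. R\<^sup>*\<^sup>* v u)" for v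
  have root: "R\<^sup>*\<^sup>* v (r v)" for v
    unfolding r_def by (rule someI[of _ v]) simp
  \<comment> \<open>Adjacent vertices reach the same vertices, so \<open>SOME\<close> is applied to
    the same predicate.\<close>
  have root_eq: "r u = r v" if "R u v" for u v
  proof -
    have "R\<^sup>*\<^sup>* u w \<longleftrightarrow> R\<^sup>*\<^sup>* v w" for w
      using that sympD[OF assms(1) that] by (meson converse_rtranclp_into_rtranclp)
    then show ?thesis
      by (simp add: r_def)
  qed
  define f where "f v = (\<exists>n. even n \<and> (R ^^ n) v (r v))" for v
  have f: "f v \<longleftrightarrow> even n" if n: "(R ^^ n) v (r v)" for v n
  proof
    assume "f v"
    then obtain k where "even k" "(R ^^ k) v (r v)"
      unfolding f_def by blast
    then have "(R ^^ (k + n)) v v"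
      using relpowp_sym[OF assms(1) n] relpowp_trans by metis
    then show "even n"
      using no_odd \<open>even k\<close> by (meson even_add)
  qed (use n f_def in blast)
  have "f u \<noteq> f v" if "R u v" for u v
  proof -
    obtain n where n: "(R ^^ n) v (r v)"
      using root[of v] by (auto simp: rtranclp_power)
    then have "(R ^^ Suc n) u (r u)"
      using that root_eq[OF that] relpowp_Suc_I2 by metis
    from f[OF this] f[OF n] show ?thesis
      by simp
  qed
  then show ?thesis
    by blast
qed

text \<open>A K4 minus an edge with ends \<open>a\<close>, \<open>b\<close> and spine
  \<open>x y\<close>. The ends may coincide, since later choices of vertices in \<open>Z\<close>
  need not be distinct.\<close>

definition diamond :: "('a \<Rightarrow> 'a \<Rightarrow> bool) \<Rightarrow> 'a \<Rightarrow> 'a \<Rightarrow> bool" where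
  "diamond E a b \<longleftrightarrow> (\<exists>x y. E x y \<and> E a x \<and> E a y \<and> E b x \<and> E b y)"

definition embeds :: "('c, 'd) pre_digraph \<Rightarrow> ('a \<Rightarrow> 'a \<Rightarrow> bool) \<Rightarrow> bool" where
  "embeds H E \<longleftrightarrow> (\<exists>f. inj_on f (verts H) \<and> (\<forall>a b. a \<rightarrow>\<^bsub>H\<^esub> b \<longrightarrow> E (f a) (f b)))"

section \<open>Odd wheels and Moser spindles\<close>

locale locally_bipartite_adjacency =
  fixes E :: "'a \<Rightarrow> 'a \<Rightarrow> bool"
  assumes E_sym: "E u v \<Longrightarrow> E v u"
    and E_irrefl: "\<not> E u u"
    and nbhd_bipartite: "\<exists>f :: 'a \<Rightarrow> bool. \<forall>a b. E v a \<and> E v b \<and> E a b \<longrightarrow> f a \<noteq> f b"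
begin

lemma no_K4: "E a b \<Longrightarrow> E a c \<Longrightarrow> E a e \<Longrightarrow> E b c \<Longrightarrow> E b e \<Longrightarrow> E c e \<Longrightarrow> False"
  using nbhd_bipartite[of a] by metis

text \<open>A 2-colouring of the neighbourhood of the hub alternates along the rim and would return
  with the wrong colour after an odd number of steps. The rim may repeat vertices.\<close>

lemma no_odd_wheel:
  assumes "closed_walk E m c" "odd m" "\<And>i. E u (c i)"
  shows False
proof -
  obtain f :: "'a \<Rightarrow> bool" where f: "\<And>a b. E u a \<Longrightarrow> E u b \<Longrightarrow> E a b \<Longrightarrow> f a \<noteq> f b"
    using nbhd_bipartite[of u] by blast
  have "f (c i) \<longleftrightarrow> (f (c 0) \<longleftrightarrow> even i)" for i
  proof (induction i)
    case (Suc i)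
    then show ?case
      using f[of "c i" "c (Suc i)"] assms(1,3) by (auto simp: closed_walk_def)
  qed simp
  from this[of m] show False
    using assms(1,2) unfolding closed_walk_def by (metis add_0)
qed

lemma embeds_H0_if_spindle:
  assumes "diamond E c a" "diamond E c b" "E a b"
  shows "embeds H0 E"
proof -
  obtain x y x' y' where
    xy: "E x y" "E c x" "E c y" "E a x" "E a y" and
    xy': "E x' y'" "E c x'" "E c y'" "E b x'" "E b y'"
    using assms unfolding diamond_def by blast
  note edges = xy xy' assms(3)
  note edges' = edges[THEN E_sym]
  \<comment> \<open>A shared spine vertex is the hub of a 5-wheel: for \<open>x = x'\<close> the rim
    is \<open>c\<close>, \<open>y\<close>, \<open>a\<close>, \<open>b\<close>,
    \<open>y'\<close>.\<close>
  have W5: "x \<noteq> x'" "x \<noteq> y'" "y \<noteq> x'" "y \<noteq> y'"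
    using nbhd_bipartite[of x] nbhd_bipartite[of y] edges edges' by metis+
  \<comment> \<open>Each of these coincidences makes \<open>c\<close> adjacent to \<open>a\<close>
    or to \<open>b\<close>, which completes a diamond to a K4.\<close>
  have "c \<noteq> a" "c \<noteq> b" "x \<noteq> b" "y \<noteq> b" "a \<noteq> x'" "a \<noteq> y'"
    using no_K4[of b c x' y'] no_K4[of a c x y] edges edges' by blast+
  moreover have "E u v \<Longrightarrow> u \<noteq> v" for u v
    using E_irrefl by blast
  ultimately have distinct: "distinct [c, x, y, a, b, x', y']"
    using edges edges' W5 by auto
  \<comment> \<open>Positions in the list are the labels of \<open>H0\<close>: the apex
    \<open>c\<close> is 0 and the edge \<open>a b\<close> is 3 4.\<close>
  define f where "f i = [c, x, y, a, b, x', y'] ! i" for i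
  have "inj_on f (verts H0)"
    using distinct unfolding f_def H0_def by (auto simp: inj_on_def nth_eq_iff_index_eq)
  moreover have "E (f i) (f j)" if "i \<rightarrow>\<^bsub>H0\<^esub> j" for i j
  proof -
    have le6: "i \<le> 6 \<longleftrightarrow> i = 0 \<or> i = 1 \<or> i = 2 \<or> i = 3 \<or> i = 4 \<or> i = 5 \<or> i = 6" for i :: nat
      by auto
    show ?thesis
      using that unfolding H0_def f_def by (auto simp: symcl_def le6 edges edges')
  qed
  ultimately show ?thesis
    unfolding embeds_def by blast
qed

end

section \<open>An independent set meeting every triangle\<close>

locale dense_spindle_free = locally_bipartite_adjacency E for E :: "'a \<Rightarrow> 'a \<Rightarrow> bool" +
  fixes V :: "'a set" and d :: nat
  assumes finite_V: "finite V" and V_nonempty: "V \<noteq> {}"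
    and E_V: "E u v \<Longrightarrow> u \<in> V"
    and degree: "v \<in> V \<Longrightarrow> d \<le> card {w. E v w}"
    and spindle_free: "diamond E c a \<Longrightarrow> diamond E c b \<Longrightarrow> \<not> E a b"
    and d_large: "8 * card V < 15 * d"
begin

lemma E_V2: "E u v \<Longrightarrow> v \<in> V"
  using E_V E_sym by blast

text \<open>Double counting of the edges between \<open>V\<close> and the listed vertices. With a
  list in place of a weight function, entries may coincide and their weights then add up.\<close>

lemma weighted_degree_count:
  fixes xs :: "('a \<times> nat) list"
  assumes "\<And>v k. (v, k) \<in> set xs \<Longrightarrow> v \<in> V"
    and "\<And>w. w \<in> V \<Longrightarrow> (\<Sum>(v, k)\<leftarrow>xs. if E w v then k else 0) \<le> m"
  shows "(\<Sum>(v, k)\<leftarrow>xs. k) * d \<le> m * card V"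
proof -
  have "(\<Sum>(v, k)\<leftarrow>xs. k) * d \<le> (\<Sum>w\<in>V. \<Sum>(v, k)\<leftarrow>xs. if E w v then k else 0)"
    using assms(1)
  proof (induction xs)
    case (Cons p xs)
    obtain v k where p: "p = (v, k)"
      by fastforce
    have "{w \<in> V. E w v} = {w. E v w}"
      using E_V E_sym by blast
    then have "(\<Sum>w\<in>V. if E w v then k else 0) = k * card {w. E v w}"
      using finite_V by (simp flip: sum.inter_filter)
    moreover have "d \<le> card {w. E v w}"
      using Cons.prems p by (intro degree) auto
    ultimately have "k * d \<le> (\<Sum>w\<in>V. if E w v then k else 0)"
      by simp
    moreover have "(\<Sum>(v, k)\<leftarrow>xs. k) * d \<le> (\<Sum>w\<in>V. \<Sum>(v, k)\<leftarrow>xs. if E w v then k else 0)"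
      by (rule Cons.IH) (use Cons.prems in auto)
    ultimately show ?case
      using p by (simp add: sum.distrib add_mult_distrib add_mono)
  qed simp
  also have "\<dots> \<le> m * card V"
    using sum_bounded_above[of V _ m] assms(2) by (simp add: mult.commute)
  finally show ?thesis .
qed

text \<open>The set \<open>J\<close> is to become the third colour class.\<close>

lemma obtain_independent_core:
  obtains J where "J \<subseteq> V" "J \<noteq> {}" "\<And>u v. u \<in> J \<Longrightarrow> v \<in> J \<Longrightarrow> \<not> E u v"
    "\<And>a b c. E a b \<Longrightarrow> E b c \<Longrightarrow> E a c \<Longrightarrow> a \<in> J \<or> b \<in> J \<or> c \<in> J"
proof -
  let ?N = "\<lambda>u v. {w. E u w \<and> E v w}"
  have fin: "finite {w. E u w}" for u
    by (rule finite_subset[OF _ finite_V]) (auto intro: E_V2)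
  define S where "S = {card (?N u v) |u v. E u v}"
  have "card (?N u v) \<le> card V" for u v
    by (rule card_mono[OF finite_V]) (auto intro: E_V2)
  then have finS: "finite S"
    unfolding S_def by (auto intro: finite_subset[of _ "{..card V}"])
  obtain v where v: "v \<in> V"
    using V_nonempty by blast
  have "0 < d"
    using d_large by auto
  then have "{w. E v w} \<noteq> {}"
    using degree[OF v] by (metis card.empty not_le)
  then have "S \<noteq> {}"
    unfolding S_def by blast
  then have "Max S \<in> S"
    using finS by simp
  then obtain x y where xy: "E x y" and Max_xy: "Max S = card (?N x y)"
    unfolding S_def by auto
  have max: "card (?N u v) \<le> card (?N x y)" if "E u v" for u v
    using Max_ge[OF finS, of "card (?N u v)"] that Max_xy unfolding S_def by auto
  define Z where "Z = ?N x y"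
  define J where "J = {w \<in> V. \<forall>z \<in> Z. \<not> E w z}"
  have Z_V: "Z \<subseteq> V"
    unfolding Z_def using E_V2 by blast
  have Z_indep: "\<not> E u v" if "u \<in> Z" "v \<in> Z" for u v
    using that no_K4[of x y u v] xy unfolding Z_def by blast
  \<comment> \<open>Both neighbourhoods avoid \<open>Z\<close>, so inclusion-exclusion takes place
    inside \<open>V - Z\<close>.\<close>
  have deg_bound: "card {w. E u w} + card {w. E v w} \<le> card (?N u v) + card (V - Z)"
    if "u \<in> J" "v \<in> J" for u v
  proof -
    have "{w. E u w} \<union> {w. E v w} \<subseteq> V - Z"
      using that E_V2 unfolding J_def by blast
    then have "card ({w. E u w} \<union> {w. E v w}) \<le> card (V - Z)"
      using finite_V by (intro card_mono) auto
    then show ?thesis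
      using card_Un_Int[OF fin fin, of u v] by (simp add: Int_def)
  qed
  have J_indep: "\<not> E u v" if "u \<in> J" "v \<in> J" for u v
  proof
    assume uv: "E u v"
    have "card (V - Z) + card Z = card V"
      using Z_V finite_V by (metis card_Diff_subset card_mono finite_subset le_add_diff_inverse2)
    \<comment> \<open>By maximality the common neighbourhood has at most |Z| elements, which leaves
      2 d \<le> |V|.\<close>
    then show False
      using deg_bound[OF that] max[OF uv] degree[of u] degree[of v] that d_large
      unfolding J_def Z_def by auto
  qed
  obtain z where z: "z \<in> Z"
  proof -
    have "card {w. E x w} + card {w. E y w} \<le> card Z + card V"
    proof -
      have "card ({w. E x w} \<union> {w. E y w}) \<le> card V"
        using finite_V E_V2 by (intro card_mono) auto
      then show ?thesis
        using card_Un_Int[OF fin fin, of x y] by (simp add: Int_def Z_def)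
    qed
    then have "card Z \<noteq> 0"
      using degree[of x] degree[of y] xy E_V[OF xy] E_V2[OF xy] d_large by auto
    then show ?thesis
      using that by fastforce
  qed
  have "z \<in> J"
    using z Z_V Z_indep unfolding J_def by blast
  have no_triangle: False if abc: "E a b" "E b c" "E a c" "a \<notin> J" "b \<notin> J" "c \<notin> J" for a b c
  proof -
    have sym: "E v u" if "E u v" for u v
      using E_sym that .
    obtain p q r where pqr: "E a p" "E b q" "E c r" "p \<in> Z" "q \<in> Z" "r \<in> Z"
      using abc E_V E_V2 unfolding J_def by blast
    \<comment> \<open>The edge \<open>x y\<close> is a spine common to all pairs in
      \<open>Z\<close>.\<close>
    have dense_Z: "diamond E s t" if "s \<in> Z" "t \<in> Z" for s t
      using that xy sym[of _ s] sym[of _ t] unfolding diamond_def Z_def by blast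
    \<comment> \<open>The total weight is 15, so the bound 8 contradicts exactly the density
      8/15.\<close>
    let ?ws = "[(x, 3), (y, 3), (a, 2), (b, 2), (c, 2), (p, 1), (q, 1), (r, 1)] :: ('a \<times> nat) list"
    have "(\<Sum>(v, k)\<leftarrow>?ws. if E w v then k else 0) \<le> 8" if "w \<in> V" for w
    proof -
      have clash: "\<not> (E w t \<and> E w u \<and> E w s)"
        if "E t u" "E t s" "E u s'" "s \<in> Z" "s' \<in> Z" for t u s s'
      proof
        \<comment> \<open>Otherwise \<open>s\<close> is the apex of a spindle on the edge \<open>u s'\<close>.\<close>
        assume "E w t \<and> E w u \<and> E w s"
        then have "diamond E s u"
          using that sym[of w] sym[of t] sym[of u] sym[of s] unfolding diamond_def by blast
        then show False
          using spindle_free dense_Z that by blast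
      qed
      have "\<not> (E w x \<and> E w y \<and> s \<in> Z \<and> E w s)" for s
        using no_K4[of w x y s] xy unfolding Z_def by blast
      then have 1: "\<not> (E w x \<and> E w y \<and> (E w p \<or> E w q \<or> E w r))"
        using pqr by blast
      have 2: "\<not> (E w a \<and> E w b \<and> E w c)"
        using no_K4[of w a b c] abc by blast
      \<comment> \<open>Such a \<open>w\<close> lies in \<open>Z\<close>, so it is the apex of a
        spindle on the edge \<open>v s\<close>: one diamond has spine \<open>t u\<close>, the other
        \<open>x y\<close>.\<close>
      have 3: "\<not> (E w x \<and> E w y \<and> E w t \<and> E w u)"
        if "E t u" "E t v" "E u v" "E v s" "s \<in> Z" for t u v s
      proof
        assume w: "E w x \<and> E w y \<and> E w t \<and> E w u"
        then have "w \<in> Z"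
          using sym[of w] unfolding Z_def by blast
        moreover have "diamond E w v"
          using w that(1) sym[OF that(2)] sym[OF that(3)] unfolding diamond_def by blast
        ultimately show False
          using spindle_free dense_Z that by blast
      qed
      have "\<not> (E w x \<and> E w y \<and> E w a \<and> E w b)" "\<not> (E w x \<and> E w y \<and> E w a \<and> E w c)"
        "\<not> (E w x \<and> E w y \<and> E w b \<and> E w c)"
        using 3[OF abc(1,3,2) pqr(3,6)] 3[OF abc(3,1) sym[OF abc(2)] pqr(2,5)]
          3[OF abc(2) sym[OF abc(1)] sym[OF abc(3)] pqr(1,4)]
        by blast+
      moreover have "\<not> (E w a \<and> E w b \<and> E w p)" "\<not> (E w b \<and> E w a \<and> E w q)"
        "\<not> (E w a \<and> E w c \<and> E w p)" "\<not> (E w c \<and> E w a \<and> E w r)"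
        "\<not> (E w b \<and> E w c \<and> E w q)" "\<not> (E w c \<and> E w b \<and> E w r)"
        using clash[OF abc(1) pqr(1,2,4,5)] clash[OF sym[OF abc(1)] pqr(2,1,5,4)]
          clash[OF abc(3) pqr(1,3,4,6)] clash[OF sym[OF abc(3)] pqr(3,1,6,4)]
          clash[OF abc(2) pqr(2,3,5,6)] clash[OF sym[OF abc(2)] pqr(3,2,6,5)]
        by blast+
      \<comment> \<open>The extreme cases weigh 6 + 2, 3 + 4 + 1 and 3 + 2 + 3, with summands from
        \<open>x\<close>, \<open>y\<close>, then \<open>a\<close>, \<open>b\<close>,
        \<open>c\<close>, then \<open>p\<close>, \<open>q\<close>, \<open>r\<close>.\<close>
      ultimately show ?thesis
        using 1 2
        by (cases "E w x"; cases "E w y"; cases "E w a"; cases "E w b"; cases "E w c"; simp)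
    qed
    moreover have "v \<in> V" if "(v, k) \<in> set ?ws" for v k
      using that E_V[OF xy] E_V2[OF xy] E_V[OF abc(1)] E_V[OF abc(2)] E_V2[OF abc(3)] pqr(4-6) Z_V
      by auto
    ultimately have "(\<Sum>(v, k)\<leftarrow>?ws. k) * d \<le> 8 * card V"
      by (intro weighted_degree_count)
    then show False
      using d_large by simp
  qed
  show thesis
  proof (rule that)
    show "J \<subseteq> V" "J \<noteq> {}"
      using \<open>z \<in> J\<close> unfolding J_def by auto
  qed (use J_indep no_triangle in blast)+
qed

end

section \<open>The shortest odd closed walk off the independent set\<close>

locale dense_spindle_free_core = dense_spindle_free E V d
  for E :: "'a \<Rightarrow> 'a \<Rightarrow> bool" and V d +
  fixes J :: "'a set"
  assumes J_V: "J \<subseteq> V" and J_nonempty: "J \<noteq> {}"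
    and J_indep: "u \<in> J \<Longrightarrow> v \<in> J \<Longrightarrow> \<not> E u v"
    and J_triangle: "E a b \<Longrightarrow> E b c \<Longrightarrow> E a c \<Longrightarrow> a \<in> J \<or> b \<in> J \<or> c \<in> J"
begin

definition R :: "'a \<Rightarrow> 'a \<Rightarrow> bool" where
  "R u v \<longleftrightarrow> E u v \<and> u \<notin> J \<and> v \<notin> J"

definition shortest_odd_walk :: "nat \<Rightarrow> (nat \<Rightarrow> 'a) \<Rightarrow> bool" where
  "shortest_odd_walk m c \<longleftrightarrow> odd m \<and> closed_walk R m c \<and>
    (\<forall>k < m. odd k \<longrightarrow> (\<forall>v. \<not> (R ^^ k) v v))"

lemma symp_R: "symp R"
  by (rule sympI) (auto simp: R_def intro: E_sym)

lemma shortest_odd_walk_rotate: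
  "shortest_odd_walk m c \<Longrightarrow> shortest_odd_walk m (\<lambda>i. c (i + s))"
  by (simp add: shortest_odd_walk_def closed_walk_rotate)

context
  fixes m c
  assumes walk: "shortest_odd_walk m c"
begin

lemma walk_R: "R (c i) (c (Suc i))"
  using walk by (simp add: shortest_odd_walk_def closed_walk_def)

lemma walk_E: "E (c i) (c (Suc i))"
  using walk_R R_def by blast

lemma walk_notin_J: "c i \<notin> J"
  using walk_R R_def by blast

lemma walk_V: "c i \<in> V"
  using walk_E E_V by blast

lemma walk_period: "c (i + m) = c i"
  using walk by (simp add: shortest_odd_walk_def closed_walk_def)

lemma walk_mod: "c (i mod m) = c i"
  using walk closed_walk_mod unfolding shortest_odd_walk_def by blast

text \<open>Each of the two arcs between \<open>c i\<close> and \<open>c j\<close> closes up through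
  \<open>w\<close>. One of the two closed walks is odd, hence of length at least \<open>m\<close>,
  so the other arc has length at most 2; parity excludes length 1.\<close>

lemma nbr_distance:
  assumes "w \<notin> J" "E w (c i)" "E w (c j)" "i < j" "j < m"
  shows "j = i + 2 \<or> j + 2 = i + m"
proof -
  have w: "R w (c i)" "R w (c j)" "R (c i) w" "R (c j) w"
    using assms walk_notin_J E_sym unfolding R_def by auto
  have cw: "closed_walk R m c" and "odd m"
    and short: "\<And>k v. odd k \<Longrightarrow> (R ^^ k) v v \<Longrightarrow> m \<le> k"
    using walk unfolding shortest_odd_walk_def by (auto simp: not_less[symmetric])
  have "(R ^^ (j - i)) (c i) (c j)"
    using closed_walk_relpowp[OF cw, of "j - i" i] assms(4) by simp
  then have short1: "(R ^^ Suc (Suc (j - i))) w w"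
    by (meson relpowp_Suc_I relpowp_Suc_I2 w(1,4))
  have "(R ^^ (m - (j - i))) (c j) (c i)"
    using closed_walk_relpowp[OF cw, of "m - (j - i)" j] assms(4,5) walk_period[of i]
    by (simp add: add.commute)
  then have short2: "(R ^^ Suc (Suc (m - (j - i)))) w w"
    by (meson relpowp_Suc_I relpowp_Suc_I2 w(2,3))
  show ?thesis
  proof (cases "odd (j - i)")
    case True
    then have "m \<le> Suc (Suc (j - i))"
      using short short1 by simp
    moreover have "even (m - 1)"
      using \<open>odd m\<close> by simp
    then have "j - i \<noteq> m - 1"
      using True by metis
    ultimately show ?thesis
      using assms(4,5) by linarith
  next
    case False
    then have "odd (Suc (Suc (m - (j - i))))"
      using \<open>odd m\<close> assms(4,5) by simp
    then have "m \<le> Suc (Suc (m - (j - i)))"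
      using short short2 by blast
    moreover have "j - i \<noteq> 1"
      using False by (metis odd_one)
    ultimately show ?thesis
      using assms(4,5) by linarith
  qed
qed

text \<open>For three neighbours the gaps \<open>j - i\<close>, \<open>k - j\<close> and their sum
  \<open>k - i < m\<close> would all be 2 or \<open>m - 2\<close>. This forces 2 + 2 =
  \<open>m - 2\<close>, but \<open>m\<close> is odd.\<close>

lemma nbr_count_notin_J:
  assumes "w \<notin> J" "5 \<le> m"
  shows "card {i. i < m \<and> E w (c i)} \<le> 2"
proof (rule ccontr)
  let ?A = "{i. i < m \<and> E w (c i)}"
  assume "\<not> ?thesis"
  then have A: "card ?A \<ge> 3"
    by simp
  have fin: "finite ?A"
    by simp
  have ne: "?A \<noteq> {}"
    using A by (metis card.empty not_numeral_le_zero)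
  have "\<not> ?A \<subseteq> {Min ?A, Max ?A}"
  proof
    assume "?A \<subseteq> {Min ?A, Max ?A}"
    then have "card ?A \<le> card {Min ?A, Max ?A}"
      by (intro card_mono) auto
    then show False
      using A card_insert_le_m1[of 2 "{Max ?A}" "Min ?A"] by simp
  qed
  then obtain j where j: "j \<in> ?A" "j \<noteq> Min ?A" "j \<noteq> Max ?A"
    by blast
  define i k where "i = Min ?A" and "k = Max ?A"
  have "i \<in> ?A" "k \<in> ?A"
    unfolding i_def k_def by (rule Min_in[OF fin ne] Max_in[OF fin ne])+
  moreover have "i < j" "j < k"
    using j(2,3) Min_le[OF fin j(1)] Max_ge[OF fin j(1)] unfolding i_def k_def by linarith+
  ultimately show False
    using nbr_distance[OF assms(1), of i j] nbr_distance[OF assms(1), of j k]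
      nbr_distance[OF assms(1), of i k] j(1) assms(2) walk
    unfolding shortest_odd_walk_def by auto
qed

lemma nbr_missing:
  assumes "\<And>i. i < m \<Longrightarrow> E u (c i)"
  shows False
proof (rule no_odd_wheel)
  show "closed_walk E m c" "odd m"
    using walk unfolding shortest_odd_walk_def closed_walk_def R_def by auto
  show "E u (c i)" for i
    using assms[of "i mod m"] walk_mod \<open>odd m\<close> by (simp add: odd_pos)
qed

lemma walk_length_ge_5: "5 \<le> m"
proof (rule ccontr)
  assume "\<not> 5 \<le> m"
  moreover have "odd m"
    using walk unfolding shortest_odd_walk_def by blast
  ultimately have "m = 1 \<or> m = 3"
    by presburger
  then show False
  proof
    assume "m = 1"
    then show False
      using walk_E[of 0] walk_period[of 0] E_irrefl by simp
  next
    assume "m = 3"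
    then have "E (c 2) (c 0)"
      using walk_E[of 2] walk_period[of 0] by (simp add: numeral_eq_Suc)
    then show False
      using walk_E[of 0] walk_E[of 1] J_triangle[of "c 0" "c 1" "c 2"] walk_notin_J E_sym
      by (auto simp: numeral_eq_Suc)
  qed
qed

lemma walk_length_less_9: "m < 9"
proof -
  obtain u where u: "u \<in> J"
    using J_nonempty by blast
  \<comment> \<open>The weight \<open>m - 3\<close> balances two cases: a vertex of \<open>J\<close>
    misses \<open>u\<close> and some walk vertex, and any other vertex sees at most two walk
    vertices besides \<open>u\<close>. The count then gives 8 (2 m - 3) < 15 (m - 1).\<close>
  let ?ws = "map (\<lambda>i. (c i, 1)) [0..<m] @ [(u, m - 3)] :: ('a \<times> nat) list"
  have "(\<Sum>(v, k)\<leftarrow>?ws. if E w v then k else 0) \<le> m - 1" if "w \<in> V" for w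
  proof -
    let ?A = "{i. i < m \<and> E w (c i)}"
    have "(\<Sum>(v, k)\<leftarrow>map (\<lambda>i. (c i, 1 :: nat)) [0..<m]. if E w v then k else 0) = card ?A"
      by (simp add: o_def interv_sum_list_conv_sum_set_nat sum.If_cases Collect_conj_eq
          lessThan_def atLeast0LessThan)
    moreover have "card ?A + (if E w u then m - 3 else 0) \<le> m - 1"
    proof (cases "w \<in> J")
      case True
      have "card ?A < card {..<m}"
        using nbr_missing[of w] by (intro psubset_card_mono) auto
      then show ?thesis
        using True J_indep u by auto
    next
      case False
      then show ?thesis
        using nbr_count_notin_J[OF False walk_length_ge_5] walk_length_ge_5 by auto
    qed
    ultimately show ?thesis
      by simp
  qed
  moreover have "v \<in> V" if "(v, k) \<in> set ?ws" for v k
    using that walk_V u J_V by auto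
  ultimately have "(\<Sum>(v, k)\<leftarrow>?ws. k) * d \<le> (m - 1) * card V"
    by (intro weighted_degree_count)
  moreover have "(\<Sum>(v, k)\<leftarrow>?ws. k) = m + (m - 3)"
    by (simp add: o_def sum_list_triv)
  ultimately have "8 * ((m + (m - 3)) * d) \<le> (m - 1) * (8 * card V)"
    by simp
  also have "\<dots> < (m - 1) * (15 * d)"
    using d_large walk_length_ge_5 by simp
  finally have "(8 * (m + (m - 3))) * d < (15 * (m - 1)) * d"
    by (simp add: algebra_simps)
  then have "8 * (m + (m - 3)) < 15 * (m - 1)"
    by simp
  then show ?thesis
    by simp
qed

end

section \<open>Excluding closed walks of length 5\<close>

lemma five_walk_miss_one:
  assumes walk: "shortest_odd_walk 5 c" and "u \<in> J" "E u (c 1)" "E u (c 2)" "E u (c 3)" "E u (c 4)"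
  shows False
proof -
  have cyc: "E (c 0) (c 1)" "E (c 1) (c 2)" "E (c 2) (c 3)" "E (c 3) (c 4)" "E (c 4) (c 0)"
    using walk_E[OF walk, of 0] walk_E[OF walk, of 1] walk_E[OF walk, of 2] walk_E[OF walk, of 3]
      walk_E[OF walk, of 4] walk_period[OF walk, of 0]
    by (simp_all add: numeral_eq_Suc)
  note edges = cyc assms(3-)
  note edges' = edges[THEN E_sym]
  let ?ws = "[(c 0, 1), (c 1, 1), (c 4, 1), (u, 1)] :: ('a \<times> nat) list"
  have "(\<Sum>(v, k)\<leftarrow>?ws. if E w v then k else 0) \<le> 2" for w
  proof (cases "w \<in> J")
    case True
    \<comment> \<open>Otherwise \<open>c 1\<close> is the apex of a spindle on the edge
      \<open>c 3\<close>, \<open>c 4\<close>, with spines \<open>w\<close>, \<open>c 0\<close> and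
      \<open>u\<close>, \<open>c 2\<close>.\<close>
    have "\<not> (E w (c 0) \<and> E w (c 1) \<and> E w (c 4))"
    proof
      assume "E w (c 0) \<and> E w (c 1) \<and> E w (c 4)"
      then have "diamond E (c 1) (c 4)"
        unfolding diamond_def using edges edges' E_sym[of w] by blast
      moreover have "diamond E (c 1) (c 3)"
        unfolding diamond_def using edges edges' by blast
      ultimately show False
        using spindle_free edges by blast
    qed
    moreover have "\<not> E w u"
      using J_indep True assms(2) .
    ultimately show ?thesis
      by auto
  next
    case False
    have "\<not> (E w (c 0) \<and> E w (c 1))" "\<not> (E w (c 0) \<and> E w (c 4))"
      using nbr_distance[OF walk False, of 0 1] nbr_distance[OF walk False, of 0 4] by auto
    \<comment> \<open>Otherwise \<open>u\<close> is the hub of a 5-wheel with rim \<open>w\<close>,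
      \<open>c 1\<close>, \<open>c 2\<close>, \<open>c 3\<close>, \<open>c 4\<close>.\<close>
    moreover have "\<not> (E w u \<and> E w (c 1) \<and> E w (c 4))"
    proof
      assume "E w u \<and> E w (c 1) \<and> E w (c 4)"
      then have "E u w" "E w (c 1)" "E w (c 4)"
        using E_sym by blast+
      then show False
        using nbhd_bipartite[of u] edges by metis
    qed
    ultimately show ?thesis
      by auto
  qed
  moreover have "v \<in> V" if "(v, k) \<in> set ?ws" for v k
    using that walk_V[OF walk] assms(2) J_V by auto
  ultimately have "(\<Sum>(v, k)\<leftarrow>?ws. k) * d \<le> 2 * card V"
    by (intro weighted_degree_count)
  then show False
    using d_large by simp
qed

lemma no_five_walk: "\<not> shortest_odd_walk 5 c"
proof
  assume walk: "shortest_odd_walk 5 c"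
  have miss: "\<not> (E u (c (s + 1)) \<and> E u (c (s + 2)) \<and> E u (c (s + 3)) \<and> E u (c (s + 4)))"
    if "u \<in> J" for u s
    using five_walk_miss_one[OF shortest_odd_walk_rotate[OF walk, of s] that]
    by (auto simp: add.commute)
  have per: "c 5 = c 0" "c 6 = c 1" "c 7 = c 2" "c 8 = c 3"
    using walk_period[OF walk, of 0] walk_period[OF walk, of 1] walk_period[OF walk, of 2]
      walk_period[OF walk, of 3] by simp_all
  obtain u where u: "u \<in> J"
    using J_nonempty by blast
  \<comment> \<open>By \<open>miss\<close>, a vertex of \<open>J\<close> sees at most three walk
    vertices; any other vertex sees at most two, plus \<open>u\<close>.\<close>
  let ?ws = "[(c 0, 1), (c 1, 1), (c 2, 1), (c 3, 1), (c 4, 1), (u, 1)] :: ('a \<times> nat) list"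
  have "(\<Sum>(v, k)\<leftarrow>?ws. if E w v then k else 0) \<le> 3" for w
  proof (cases "w \<in> J")
    case True
    have "\<not> (E w (c 1) \<and> E w (c 2) \<and> E w (c 3) \<and> E w (c 4))"
      "\<not> (E w (c 2) \<and> E w (c 3) \<and> E w (c 4) \<and> E w (c 0))"
      "\<not> (E w (c 3) \<and> E w (c 4) \<and> E w (c 0) \<and> E w (c 1))"
      "\<not> (E w (c 4) \<and> E w (c 0) \<and> E w (c 1) \<and> E w (c 2))"
      "\<not> (E w (c 0) \<and> E w (c 1) \<and> E w (c 2) \<and> E w (c 3))"
      using miss[OF True, of 0] miss[OF True, of 1] miss[OF True, of 2] miss[OF True, of 3]
        miss[OF True, of 4] by (simp_all add: per del: One_nat_def add_2_eq_Suc')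
    then show ?thesis
      using J_indep[OF True u]
      by (cases "E w (c 0)"; cases "E w (c 1)"; cases "E w (c 2)"; cases "E w (c 3)"; simp)
  next
    case False
    have "\<not> (E w (c 0) \<and> E w (c 1))" "\<not> (E w (c 1) \<and> E w (c 2))" "\<not> (E w (c 2) \<and> E w (c 3))"
      "\<not> (E w (c 3) \<and> E w (c 4))" "\<not> (E w (c 0) \<and> E w (c 4))"
      using nbr_distance[OF walk False, of 0 1] nbr_distance[OF walk False, of 1 2]
        nbr_distance[OF walk False, of 2 3] nbr_distance[OF walk False, of 3 4]
        nbr_distance[OF walk False, of 0 4] by auto
    then show ?thesis
      by (cases "E w (c 0)"; cases "E w (c 1)"; cases "E w (c 2)"; cases "E w (c 3)"; simp)
  qed
  moreover have "v \<in> V" if "(v, k) \<in> set ?ws" for v k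
    using that walk_V[OF walk] u J_V by auto
  ultimately have "(\<Sum>(v, k)\<leftarrow>?ws. k) * d \<le> 3 * card V"
    by (intro weighted_degree_count)
  then show False
    using d_large by simp
qed

section \<open>Neighbours on closed walks of length 7\<close>

lemma seven_walk_nbrs:
  assumes walk: "shortest_odd_walk 7 c" and "w \<notin> J"
  shows "\<not> (E w (c 0) \<and> E w (c 1))"
    "\<not> (E w (c 0) \<and> E w (c 3))"
    "\<not> (E w (c 0) \<and> E w (c 4))"
    "\<not> (E w (c 0) \<and> E w (c 6))"
    "\<not> (E w (c 1) \<and> E w (c 2))"
    "\<not> (E w (c 1) \<and> E w (c 4))"
    "\<not> (E w (c 1) \<and> E w (c 5))"
    "\<not> (E w (c 2) \<and> E w (c 3))"
    "\<not> (E w (c 2) \<and> E w (c 5))"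
    "\<not> (E w (c 2) \<and> E w (c 6))"
    "\<not> (E w (c 3) \<and> E w (c 4))"
    "\<not> (E w (c 3) \<and> E w (c 6))"
    "\<not> (E w (c 4) \<and> E w (c 5))"
    "\<not> (E w (c 5) \<and> E w (c 6))"
  using nbr_distance[OF assms, of 0 1]
    nbr_distance[OF assms, of 0 3]
    nbr_distance[OF assms, of 0 4]
    nbr_distance[OF assms, of 0 6]
    nbr_distance[OF assms, of 1 2]
    nbr_distance[OF assms, of 1 4]
    nbr_distance[OF assms, of 1 5]
    nbr_distance[OF assms, of 2 3]
    nbr_distance[OF assms, of 2 5]
    nbr_distance[OF assms, of 2 6]
    nbr_distance[OF assms, of 3 4]
    nbr_distance[OF assms, of 3 6]
    nbr_distance[OF assms, of 4 5]
    nbr_distance[OF assms, of 5 6]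
  by auto

lemma seven_walk_nbr_missing:
  assumes "shortest_odd_walk 7 c"
  shows "\<not> (E u (c 0) \<and> E u (c 1) \<and> E u (c 2) \<and> E u (c 3) \<and> E u (c 4) \<and> E u (c 5) \<and> E u (c 6))"
proof
  assume u: "E u (c 0) \<and> E u (c 1) \<and> E u (c 2) \<and> E u (c 3) \<and> E u (c 4) \<and> E u (c 5) \<and> E u (c 6)"
  have "E u (c i)" if "i < 7" for i
  proof -
    have "i \<in> {0, 1, 2, 3, 4, 5, 6}"
      using that by auto
    then show ?thesis
      using u by auto
  qed
  then show False
    using nbr_missing[OF assms] by blast
qed

text \<open>If a vertex of \<open>J\<close> misses only one walk vertex, that one is
  \<open>c 0\<close>, \<open>c 1\<close> or \<open>c 4\<close>. These get weight 2, so every vertex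
  of \<open>J\<close> loses at least 2 of the walk weight 10. No two of the three are at distance 2,
  so a vertex off \<open>J\<close> sees at most 3 on the walk, plus 5 for \<open>u\<close>.\<close>

lemma seven_walk_missing_014:
  assumes walk: "shortest_odd_walk 7 c"
    and miss: "\<And>u. u \<in> J \<Longrightarrow> \<not> (E u (c 0) \<and> E u (c 1) \<and> E u (c 3) \<and> E u (c 4) \<and> E u (c 5) \<and> E u (c 6))"
    "\<And>u. u \<in> J \<Longrightarrow> \<not> (E u (c 0) \<and> E u (c 1) \<and> E u (c 2) \<and> E u (c 4) \<and> E u (c 5) \<and> E u (c 6))"
    "\<And>u. u \<in> J \<Longrightarrow> \<not> (E u (c 0) \<and> E u (c 1) \<and> E u (c 2) \<and> E u (c 3) \<and> E u (c 4) \<and> E u (c 6))"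
    "\<And>u. u \<in> J \<Longrightarrow> \<not> (E u (c 0) \<and> E u (c 1) \<and> E u (c 2) \<and> E u (c 3) \<and> E u (c 4) \<and> E u (c 5))"
  shows False
proof -
  obtain u where u: "u \<in> J"
    using J_nonempty by blast
  let ?ws = "[(c 0, 2), (c 1, 2), (c 2, 1), (c 3, 1), (c 4, 2), (c 5, 1), (c 6, 1), (u, 5)]
    :: ('a \<times> nat) list"
  have "(\<Sum>(v, k)\<leftarrow>?ws. if E w v then k else 0) \<le> 8" for w
  proof (cases "w \<in> J")
    case True
    then show ?thesis
      using miss[OF True] seven_walk_nbr_missing[OF walk, of w] J_indep[OF True u]
      by (cases "E w (c 0)"; cases "E w (c 1)"; cases "E w (c 2)"; cases "E w (c 3)";
          cases "E w (c 4)"; cases "E w (c 5)"; cases "E w (c 6)"; simp)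
  next
    case False
    then show ?thesis
      using seven_walk_nbrs[OF walk False]
      by (cases "E w (c 0)"; cases "E w (c 1)"; cases "E w (c 2)"; cases "E w (c 3)";
          cases "E w (c 4)"; cases "E w (c 5)"; cases "E w (c 6)"; simp)
  qed
  moreover have "v \<in> V" if "(v, k) \<in> set ?ws" for v k
    using that walk_V[OF walk] u J_V by auto
  ultimately have "(\<Sum>(v, k)\<leftarrow>?ws. k) * d \<le> 8 * card V"
    by (intro weighted_degree_count)
  then show False
    using d_large by simp
qed

section \<open>Two 7-wheels with a missing spoke, at distance 2\<close>

context
  fixes c u1 u6
  assumes walk: "shortest_odd_walk 7 c"
    and u1: "u1 \<in> J" "E u1 (c 0)" "E u1 (c 2)" "E u1 (c 3)" "E u1 (c 4)" "E u1 (c 5)" "E u1 (c 6)"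
    and u6: "u6 \<in> J" "E u6 (c 0)" "E u6 (c 1)" "E u6 (c 2)" "E u6 (c 3)" "E u6 (c 4)" "E u6 (c 5)"
begin

lemma seven_walk_edges: "E (c 0) (c 1)" "E (c 1) (c 2)" "E (c 2) (c 3)" "E (c 3) (c 4)" "E (c 4) (c 5)" "E (c 5) (c 6)" "E (c 6) (c 0)"
  using walk_E[OF walk, of 0] walk_E[OF walk, of 1] walk_E[OF walk, of 2] walk_E[OF walk, of 3]
    walk_E[OF walk, of 4] walk_E[OF walk, of 5] walk_E[OF walk, of 6] walk_period[OF walk, of 0]
  by (simp_all add: numeral_eq_Suc)

lemma u1_u6_missing: "\<not> E u1 (c 1)" "\<not> E u6 (c 6)"
  using seven_walk_nbr_missing[OF walk] u1 u6 by blast+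

lemma two_missing_degree: "13 * d \<le> 7 * card V"
proof -
  \<comment> \<open>The total is 13. A vertex off \<open>J\<close> could exceed 7 only by seeing
    \<open>c 0\<close>, a second walk vertex and \<open>u1\<close>, \<open>u6\<close>; the two wheel
    arguments below prevent this.\<close>
  let ?ws = "[(c 0, 2), (c 1, 1), (c 2, 1), (c 3, 1), (c 4, 1), (c 5, 1), (c 6, 1), (u1, 4), (u6, 1)]
    :: ('a \<times> nat) list"
  have "(\<Sum>(v, k)\<leftarrow>?ws. if E w v then k else 0) \<le> 7" for w
  proof (cases "w \<in> J")
    case True
    then show ?thesis
      using seven_walk_nbr_missing[OF walk, of w] J_indep[OF True u1(1)] J_indep[OF True u6(1)]
      by (cases "E w (c 0)"; cases "E w (c 1)"; cases "E w (c 2)"; cases "E w (c 3)";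
          cases "E w (c 4)"; cases "E w (c 5)"; cases "E w (c 6)"; simp)
  next
    case False
    \<comment> \<open>Here \<open>w\<close> would take the place of the missing \<open>c 1\<close>
      and complete the 7-wheel around \<open>u1\<close>.\<close>
    have "\<not> (E w u1 \<and> E w (c 0) \<and> E w (c 2))"
    proof
      assume "E w u1 \<and> E w (c 0) \<and> E w (c 2)"
      then have "E u1 w" "E w (c 2)" "E (c 0) w"
        using E_sym by blast+
      then show False
        using nbhd_bipartite[of u1] u1(2-) seven_walk_edges by metis
    qed
    moreover have "\<not> (E w u6 \<and> E w (c 0) \<and> E w (c 5))"
    proof
      assume "E w u6 \<and> E w (c 0) \<and> E w (c 5)"
      then have "E u6 w" "E w (c 0)" "E (c 5) w"
        using E_sym by blast+
      then show False
        using nbhd_bipartite[of u6] u6(2-) seven_walk_edges by metis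
    qed
    ultimately show ?thesis
      using seven_walk_nbrs[OF walk False]
      by (cases "E w (c 0)"; cases "E w (c 1)"; cases "E w (c 2)"; cases "E w (c 3)";
          cases "E w (c 4)"; cases "E w (c 5)"; cases "E w (c 6)"; simp)
  qed
  moreover have "v \<in> V" if "(v, k) \<in> set ?ws" for v k
    using that walk_V[OF walk] u1(1) u6(1) J_V by auto
  ultimately have "(\<Sum>(v, k)\<leftarrow>?ws. k) * d \<le> 7 * card V"
    by (intro weighted_degree_count)
  then show ?thesis
    by simp
qed

lemma two_missing_common_nbr: "\<exists>t. E t (c 0) \<and> E t u1 \<and> E t u6"
proof (rule ccontr)
  assume no: "\<not> ?thesis"
  \<comment> \<open>The total is 19, and 10/19 < 8/15. Without a common neighbour, a vertex off
    \<open>J\<close> gets at most 6 + 4 if it sees \<open>c 0\<close> and at most 2 + 8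
    otherwise.\<close>
  let ?ws = "[(c 0, 5), (c 1, 1), (c 2, 1), (c 3, 1), (c 4, 1), (c 5, 1), (c 6, 1), (u1, 4), (u6, 4)]
    :: ('a \<times> nat) list"
  have "(\<Sum>(v, k)\<leftarrow>?ws. if E w v then k else 0) \<le> 10" for w
  proof (cases "w \<in> J")
    case True
    then show ?thesis
      using seven_walk_nbr_missing[OF walk, of w] J_indep[OF True u1(1)] J_indep[OF True u6(1)]
      by (cases "E w (c 0)"; cases "E w (c 1)"; cases "E w (c 2)"; cases "E w (c 3)";
          cases "E w (c 4)"; cases "E w (c 5)"; cases "E w (c 6)"; simp)
  next
    case False
    moreover have "\<not> (E w (c 0) \<and> E w u1 \<and> E w u6)"
      using no by blast
    ultimately show ?thesis
      using seven_walk_nbrs[OF walk False]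
      by (cases "E w (c 0)"; cases "E w (c 1)"; cases "E w (c 2)"; cases "E w (c 3)";
          cases "E w (c 4)"; cases "E w (c 5)"; cases "E w (c 6)"; simp)
  qed
  moreover have "v \<in> V" if "(v, k) \<in> set ?ws" for v k
    using that walk_V[OF walk] u1(1) u6(1) J_V by auto
  ultimately have "(\<Sum>(v, k)\<leftarrow>?ws. k) * d \<le> 10 * card V"
    by (intro weighted_degree_count)
  then show False
    using d_large by simp
qed

text \<open>A repeated vertex splits the walk into two closed walks, one of them odd and shorter
  than 7.\<close>

lemma walk_inj: "inj_on c {0..6}"
proof -
  have "c i \<noteq> c j" if "i < j" "j \<le> 6" for i j
  proof
    assume eq: "c i = c j"
    have cw: "closed_walk R 7 c" and short: "\<And>k v. odd k \<Longrightarrow> (R ^^ k) v v \<Longrightarrow> 7 \<le> k"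
      using walk unfolding shortest_odd_walk_def by (auto simp: not_less[symmetric])
    have "(R ^^ (j - i)) (c i) (c i)"
      using closed_walk_relpowp[OF cw, of "j - i" i] that eq by simp
    moreover have "(R ^^ (7 - (j - i))) (c i) (c i)"
      using closed_walk_relpowp[OF cw, of "7 - (j - i)" j] that walk_period[OF walk, of i] eq
      by (simp add: add.commute)
    moreover have "odd (j - i) \<or> odd (7 - (j - i))"
      using that by presburger
    ultimately show False
      using short[of "j - i" "c i"] short[of "7 - (j - i)" "c i"] that by auto
  qed
  then show ?thesis
    by (metis inj_onI atLeastAtMost_iff nat_neq_iff)
qed

lemma embeds_T0: "embeds T0 E"
proof -
  obtain t where t: "E t (c 0)" "E t u1" "E t u6"
    using two_missing_common_nbr by blast
  have tJ: "t \<notin> J"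
    using t u1(1) J_indep by blast
  \<comment> \<open>Only \<open>c 1\<close> and \<open>c 6\<close> are walk vertices adjacent to
    \<open>c 0\<close>, and \<open>u1\<close> misses the first, \<open>u6\<close> the
    second.\<close>
  have t_c: "t \<noteq> c i" if "i \<le> 6" for i
  proof
    assume eq: "t = c i"
    have "i \<in> {0, 1, 2, 3, 4, 5, 6}"
      using that by auto
    then show False
      using eq t seven_walk_edges seven_walk_edges[THEN E_sym] seven_walk_nbrs[OF walk tJ]
        u1_u6_missing E_sym[OF t(2)] E_sym[OF t(3)] E_irrefl by auto
  qed
  define f where "f x = (case x of T0_v i \<Rightarrow> c i | T0_u1 \<Rightarrow> u1 | T0_u6 \<Rightarrow> u6 | T0_t \<Rightarrow> t)" for x
  have "u1 \<noteq> u6"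
    using u1_u6_missing u6 by blast
  have ne: "c i \<noteq> u1" "c i \<noteq> u6" "t \<noteq> u1" "t \<noteq> u6" for i
    using walk_notin_J[OF walk] u1(1) u6(1) tJ by metis+
  have "inj_on f (verts T0)"
    unfolding T0_def f_def
    by (auto intro!: inj_onI
        simp: inj_on_eq_iff[OF walk_inj] \<open>u1 \<noteq> u6\<close> \<open>u1 \<noteq> u6\<close>[symmetric] ne ne[symmetric] t_c t_c[symmetric])
  moreover have "E (f x) (f y)" if "x \<rightarrow>\<^bsub>T0\<^esub> y" for x y
  proof -
    have le6: "i \<le> 6 \<longleftrightarrow> i = 0 \<or> i = 1 \<or> i = 2 \<or> i = 3 \<or> i = 4 \<or> i = 5 \<or> i = 6" for i :: nat
      by auto
    note edges = seven_walk_edges u1(2-) u6(2-) t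
    show ?thesis
      using that unfolding T0_def f_def by (auto simp: symcl_def le6 edges edges[THEN E_sym] simp del: One_nat_def)
  qed
  ultimately show ?thesis
    unfolding embeds_def by blast
qed

end

lemma seven_walk:
  assumes walk: "shortest_odd_walk 7 c"
  shows "embeds T0 E \<and> 13 * d \<le> 7 * card V"
proof -
  \<comment> \<open>\<open>M s\<close>: some vertex of \<open>J\<close> is adjacent to all of the walk except possibly \<open>c s\<close>.
    Unless \<open>M\<close> holds at two positions at distance 2, it is confined to a rotation of \<open>{0, 1, 4}\<close>.\<close>
  define M where "M s \<longleftrightarrow> (\<exists>u \<in> J. \<forall>k \<in> {1..6}. E u (c (s + k)))" for s
  have per: "c (i + 7) = c i" for i
    using walk_period[OF walk] .
  have "c (s + 7 + k) = c (s + k)" for s k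
    using per[of "s + k"] by (simp add: algebra_simps)
  then have M_per: "M (s + 7) = M s" for s
    by (simp add: M_def)
  have "\<exists>s. M s \<and> M (s + 2)"
  proof (rule ccontr)
    assume "\<not> ?thesis"
    then have no: "\<not> (M s \<and> M (s + 2))" for s
      by blast
    have M_I: "M (s + j)" if "u \<in> J" "j < 7" and u: "\<forall>k<7. k \<noteq> j \<longrightarrow> E u (c (k + s))" for u s j
      unfolding M_def
    proof (intro bexI[of _ u] ballI)
      fix k :: nat
      assume k: "k \<in> {1..6}"
      show "E u (c (s + j + k))"
      proof (cases "j + k < 7")
        case True
        then show ?thesis
          using u[rule_format, of "j + k"] k by (simp add: ac_simps)
      next
        case False
        then show ?thesis
          using u[rule_format, of "j + k - 7"] k \<open>j < 7\<close> per[of "j + k - 7 + s"] by (simp add: ac_simps)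
      qed
    qed fact
    have less7: "k < 7 \<longleftrightarrow> k = 0 \<or> k = 1 \<or> k = 2 \<or> k = 3 \<or> k = 4 \<or> k = 5 \<or> k = 6" for k :: nat
      by auto
    \<comment> \<open>For each rotation, some position outside \<open>s\<close> + {0, 1, 4}
      satisfies \<open>M\<close>.\<close>
    have some: "M (s + 2) \<or> M (s + 3) \<or> M (s + 5) \<or> M (s + 6)" for s
    proof (rule ccontr)
      assume none: "\<not> ?thesis"
      have miss: "\<not> (\<forall>k<7. k \<noteq> j \<longrightarrow> E u (c (k + s)))" if "u \<in> J" "j \<in> {2, 3, 5, 6}" for u j
      proof
        assume "\<forall>k<7. k \<noteq> j \<longrightarrow> E u (c (k + s))"
        from M_I[OF that(1) _ this] show False
          using that(2) none by auto
      qed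
      show False
        by (rule seven_walk_missing_014[OF shortest_odd_walk_rotate[OF walk, of s]];
            drule miss; auto simp: less7)
    qed
    \<comment> \<open>Steps of 2 arrange the residues modulo 7 in a 7-cycle whose maximal
      independent sets are exactly the rotations of {0, 1, 4}.\<close>
    show False
      using no[of 0] no[of 1] no[of 2] no[of 3] no[of 4] no[of 5] no[of 6]
        some[of 0] some[of 1] some[of 2] some[of 3] some[of 4] some[of 5] some[of 6]
        M_per[of 0] M_per[of 1] M_per[of 2] M_per[of 3] M_per[of 4] M_per[of 5]
      by (simp del: One_nat_def add_2_eq_Suc') blast
  qed
  then obtain s u6 u1 where "u6 \<in> J" "u1 \<in> J"
    and u6: "\<And>k. 1 \<le> k \<Longrightarrow> k \<le> 6 \<Longrightarrow> E u6 (c (s + k))"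
    and u1: "\<And>k. 1 \<le> k \<Longrightarrow> k \<le> 6 \<Longrightarrow> E u1 (c (s + 2 + k))"
    unfolding M_def by (meson atLeastAtMost_iff)
  \<comment> \<open>After a shift by \<open>s + 1\<close>, the possibly missed vertices
    \<open>c s\<close> and \<open>c (s + 2)\<close> have the indices 6 and 1.\<close>
  have u6': "E u6 (c (k + (s + 1)))" if "k \<le> 5" for k
    using u6[of "k + 1"] that by (simp add: ac_simps)
  have u1': "E u1 (c (k + (s + 1)))" if "2 \<le> k" "k \<le> 7" for k
    using u1[of "k - 1"] that by (simp add: ac_simps)
  have u10: "E u1 (c (0 + (s + 1)))"
    using u1'[of 7] per[of "s + 1"] by (simp add: ac_simps)
  show ?thesis
  proof
    show "embeds T0 E"
      by (rule embeds_T0[OF shortest_odd_walk_rotate[OF walk, of "s + 1"], of u1 u6])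
        (rule \<open>u1 \<in> J\<close> \<open>u6 \<in> J\<close> u10 | (rule u1' u6'; simp))+
    show "13 * d \<le> 7 * card V"
      by (rule two_missing_degree[OF shortest_odd_walk_rotate[OF walk, of "s + 1"], of u1 u6])
        (rule \<open>u1 \<in> J\<close> \<open>u6 \<in> J\<close> u10 | (rule u1' u6'; simp))+
  qed
qed

text \<open>If \<open>R\<close> has no odd closed walk, its 2-colouring and a third colour on
  \<open>J\<close> suffice; otherwise a shortest one has length 7.\<close>

lemma three_colouring_or_embeds_T0:
  "(\<exists>f :: 'a \<Rightarrow> nat. (\<forall>v. f v < 3) \<and> (\<forall>u v. E u v \<longrightarrow> f u \<noteq> f v)) \<or>
    embeds T0 E \<and> 13 * d \<le> 7 * card V"
proof (cases "\<exists>n v. odd n \<and> (R ^^ n) v v")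
  case True
  define m where "m = (LEAST n. odd n \<and> (\<exists>v. (R ^^ n) v v))"
  have m: "odd m" "\<exists>v. (R ^^ m) v v"
    using LeastI_ex[of "\<lambda>n. odd n \<and> (\<exists>v. (R ^^ n) v v)"] True unfolding m_def by blast+
  have short: "\<not> (R ^^ k) v v" if "k < m" "odd k" for k v
    using not_less_Least[of k "\<lambda>n. odd n \<and> (\<exists>v. (R ^^ n) v v)"] that unfolding m_def by blast
  obtain c where "closed_walk R m c"
    using m relpowp_closed_walk[of m R] odd_pos by blast
  then have walk: "shortest_odd_walk m c"
    using m short unfolding shortest_odd_walk_def by blast
  have "m = 5 \<or> m = 7"
    using walk_length_ge_5[OF walk] walk_length_less_9[OF walk] m(1) by presburger
  then show ?thesis
    using walk no_five_walk seven_walk by blast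
next
  case False
  then obtain g :: "'a \<Rightarrow> bool" where g: "\<And>u v. R u v \<Longrightarrow> g u \<noteq> g v"
    using two_colouring_if_no_odd_closed_walk[OF symp_R] by blast
  define f :: "'a \<Rightarrow> nat" where "f v = (if v \<in> J then 2 else if g v then 1 else 0)" for v
  have "f u \<noteq> f v" if "E u v" for u v
    using g[of u v] J_indep[of u v] that unfolding f_def R_def by auto
  moreover have "f v < 3" for v
    unfolding f_def by simp
  ultimately show ?thesis
    by blast
qed

end

section \<open>Back to digraphs\<close>

text \<open>\<open>embeds\<close> speaks of adjacency only. Images of vertices lie in
  \<open>G\<close> because \<open>H\<close> has no isolated vertex, and the choice of arcs is
  injective because \<open>H\<close> has no parallel arcs.\<close>

lemma contains_subgraphI:
  assumes "graph G" "wf_digraph H" "nomulti_digraph H" "embeds H (\<lambda>u v. u \<rightarrow>\<^bsub>G\<^esub> v)"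
    and "\<And>v. v \<in> verts H \<Longrightarrow> \<exists>w. v \<rightarrow>\<^bsub>H\<^esub> w"
  shows "contains_subgraph G H"
proof -
  interpret G: graph G by fact
  interpret H: wf_digraph H by fact
  interpret H: nomulti_digraph H by fact
  obtain f where inj: "inj_on f (verts H)" and f: "\<And>a b. a \<rightarrow>\<^bsub>H\<^esub> b \<Longrightarrow> f a \<rightarrow>\<^bsub>G\<^esub> f b"
    using assms(4) unfolding embeds_def by blast
  have "\<exists>e'. e' \<in> arcs G \<and> tail G e' = f (tail H e) \<and> head G e' = f (head H e)" if "e \<in> arcs H" for e
    using f[of "tail H e" "head H e"] that by (auto simp: arcs_ends_conv)
  then obtain g where g: "\<And>e. e \<in> arcs H \<Longrightarrow>
      g e \<in> arcs G \<and> tail G (g e) = f (tail H e) \<and> head G (g e) = f (head H e)"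
    by metis
  define h where "h = \<lparr>iso_verts = f, iso_arcs = g, iso_head = head G, iso_tail = tail G\<rparr>"
  have "inj_on g (arcs H)"
  proof (rule inj_onI)
    fix e e'
    assume e: "e \<in> arcs H" "e' \<in> arcs H" "g e = g e'"
    then have "f (tail H e) = f (tail H e')" "f (head H e) = f (head H e')"
      using g by metis+
    then have "tail H e = tail H e'" "head H e = head H e'"
      using e inj by (auto dest: inj_onD)
    then show "e = e'"
      using e H.no_multi_arcs by (simp add: arc_to_ends_def)
  qed
  then have "pre_digraph.digraph_isomorphism H h"
    using inj g assms(2) unfolding pre_digraph.digraph_isomorphism_def h_def by simp
  moreover have "subgraph (app_iso h H) G"
    unfolding subgraph_def
  proof (intro conjI)
    show "verts (app_iso h H) \<subseteq> verts G"
    proof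
      fix v
      assume "v \<in> verts (app_iso h H)"
      then obtain a where "a \<in> verts H" "v = f a"
        by (auto simp: h_def)
      then show "v \<in> verts G"
        using assms(5)[of a] f G.adj_in_verts(1) by blast
    qed
    show "wf_digraph (app_iso h H)"
      by unfold_locales (auto simp: h_def g)
  qed (use g in \<open>auto simp: h_def compatible_def intro: G.wf_digraph\<close>)
  ultimately show ?thesis
    unfolding contains_subgraph_def digraph_iso_def by blast
qed

lemma contains_H0I:
  assumes "graph G" "embeds H0 (\<lambda>u v. u \<rightarrow>\<^bsub>G\<^esub> v)"
  shows "contains_subgraph G H0"
  using assms(1) _ _ assms(2)
proof (rule contains_subgraphI)
  show "wf_digraph H0"
    by unfold_locales (auto simp: H0_def symcl_def)
  then show "nomulti_digraph H0"
    by (auto simp: nomulti_digraph_def nomulti_digraph_axioms_def H0_def arc_to_ends_def)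
  show "\<exists>w. v \<rightarrow>\<^bsub>H0\<^esub> w" if "v \<in> verts H0" for v
    using that by (auto simp: H0_def symcl_def)
qed

lemma contains_T0I:
  assumes "graph G" "embeds T0 (\<lambda>u v. u \<rightarrow>\<^bsub>G\<^esub> v)"
  shows "contains_subgraph G T0"
  using assms(1) _ _ assms(2)
proof (rule contains_subgraphI)
  show "wf_digraph T0"
    by unfold_locales (auto simp: T0_def symcl_def)
  then show "nomulti_digraph T0"
    by (auto simp: nomulti_digraph_def nomulti_digraph_axioms_def T0_def arc_to_ends_def)
  show "\<exists>w. v \<rightarrow>\<^bsub>T0\<^esub> w" if "v \<in> verts T0" for v
    using that by (auto simp: T0_def symcl_def)
qed

lemma (in graph) out_degree_eq_card_nbrs: "out_degree G v = card {w. v \<rightarrow> w}"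
proof -
  have "{w. v \<rightarrow> w} = head G ` out_arcs G v"
    by (auto simp: arcs_ends_conv out_arcs_def)
  moreover have "inj_on (head G) (out_arcs G v)"
    by (auto intro!: inj_onI no_multi_arcs simp: out_arcs_def arc_to_ends_def)
  ultimately show ?thesis
    by (simp add: out_degree_def card_image)
qed

lemma nbhd_two_colouring:
  assumes "graph G" "locally_bipartite G"
  shows "\<exists>f :: 'a \<Rightarrow> bool. \<forall>a b. v \<rightarrow>\<^bsub>G\<^esub> a \<and> v \<rightarrow>\<^bsub>G\<^esub> b \<and> a \<rightarrow>\<^bsub>G\<^esub> b \<longrightarrow> f a \<noteq> f b"
proof (cases "v \<in> verts G")
  case True
  interpret graph G by fact
  obtain A B where AB: "A \<inter> B = {}" and
    edge: "\<And>a b. a \<rightarrow>\<^bsub>G \<restriction> neighbourhood G v\<^esub> b \<Longrightarrow> a \<in> A \<and> b \<in> B \<or> a \<in> B \<and> b \<in> A"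
    using assms(2) True unfolding locally_bipartite_def bipartite_def by meson
  have "a \<rightarrow>\<^bsub>G \<restriction> neighbourhood G v\<^esub> b" if "v \<rightarrow>\<^bsub>G\<^esub> a" "v \<rightarrow>\<^bsub>G\<^esub> b" "a \<rightarrow>\<^bsub>G\<^esub> b" for a b
    using that(3) adj_in_verts(2)[OF that(1)] adj_in_verts(2)[OF that(2)] that(1,2)
    by (auto simp: arcs_ends_conv induce_subgraph_def neighbourhood_def image_iff)
  then show ?thesis
    using edge AB by (intro exI[of _ "\<lambda>a. a \<in> A"]) blast
next
  case False
  interpret graph G by fact
  show ?thesis
    using False adj_in_verts(1) by blast
qed

text \<open>Serves both thresholds: above 7/13 the inequality in the last disjunct fails.\<close>

lemma three_colourable_or_contains:
  assumes "graph G" "locally_bipartite G"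
    and large: "8 * card (verts G) < 15 * min_degree G"
  shows "colourable 3 G \<or> contains_subgraph G H0 \<or>
    contains_subgraph G T0 \<and> 13 * min_degree G \<le> 7 * card (verts G)"
\<comment> \<open>The empty graph is separated because its \<open>min_degree\<close> is
  unspecified.\<close>
proof (cases "verts G = {} \<or> contains_subgraph G H0")
  case True
  interpret graph G by fact
  show ?thesis
    using True adj_in_verts(1) unfolding colourable_def by blast
next
  case False
  interpret graph G by fact
  let ?E = "\<lambda>u v. u \<rightarrow>\<^bsub>G\<^esub> v"
  have E: "locally_bipartite_adjacency ?E"
  proof
    show "\<And>u v. u \<rightarrow>\<^bsub>G\<^esub> v \<Longrightarrow> v \<rightarrow>\<^bsub>G\<^esub> u"
      using arcs_ends_symmetric[OF sym_arcs] .
    show "\<And>u. \<not> u \<rightarrow>\<^bsub>G\<^esub> u"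
      using adj_not_same by blast
  qed (use nbhd_two_colouring[OF assms(1,2)] in blast)
  interpret dense_spindle_free ?E "verts G" "min_degree G"
    using E
  proof (rule dense_spindle_free.intro, unfold_locales)
    show "min_degree G \<le> card {w. v \<rightarrow>\<^bsub>G\<^esub> w}" if "v \<in> verts G" for v
      using that by (auto simp: min_degree_def simp flip: out_degree_eq_card_nbrs)
    show "\<not> a \<rightarrow>\<^bsub>G\<^esub> b" if "diamond ?E c a" "diamond ?E c b" for a b c
      using locally_bipartite_adjacency.embeds_H0_if_spindle[OF E that] contains_H0I[OF assms(1)] False
      by blast
    show "\<And>u v. u \<rightarrow>\<^bsub>G\<^esub> v \<Longrightarrow> u \<in> verts G"
      by (rule adj_in_verts(1))
  qed (use False large finite_verts in simp_all)
  obtain J where "J \<subseteq> verts G" "J \<noteq> {}" "\<And>u v. u \<in> J \<Longrightarrow> v \<in> J \<Longrightarrow> \<not> u \<rightarrow>\<^bsub>G\<^esub> v"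
    "\<And>a b c. a \<rightarrow>\<^bsub>G\<^esub> b \<Longrightarrow> b \<rightarrow>\<^bsub>G\<^esub> c \<Longrightarrow> a \<rightarrow>\<^bsub>G\<^esub> c \<Longrightarrow> a \<in> J \<or> b \<in> J \<or> c \<in> J"
    by (rule obtain_independent_core) (rule that)
  then interpret dense_spindle_free_core ?E "verts G" "min_degree G" J
    by unfold_locales
  show ?thesis
    using three_colouring_or_embeds_T0 contains_T0I[OF assms(1)] unfolding colourable_def by blast
qed

theorem theorem3p2:
  fixes G :: "('a, 'b) pre_digraph"
  assumes "graph G"
    and "locally_bipartite G"
  shows "(real (min_degree G) > 8 / 15 * real (card (verts G)) \<longrightarrow>
            colourable 3 G \<or> contains_subgraph G H0 \<or> contains_subgraph G T0) \<and>
         (real (min_degree G) > 7 / 13 * real (card (verts G)) \<longrightarrow>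
            colourable 3 G \<or> contains_subgraph G H0)"
proof (intro conjI impI)
  assume "real (min_degree G) > 8 / 15 * real (card (verts G))"
  then have "8 * card (verts G) < 15 * min_degree G"
    by linarith
  then show "colourable 3 G \<or> contains_subgraph G H0 \<or> contains_subgraph G T0"
    using three_colourable_or_contains[OF assms] by blast
next
  assume "real (min_degree G) > 7 / 13 * real (card (verts G))"
  \<comment> \<open>As 7/13 > 8/15, the stronger bound implies the weaker one.\<close>
  then have "8 * card (verts G) < 15 * min_degree G" "7 * card (verts G) < 13 * min_degree G"
    by linarith+
  then show "colourable 3 G \<or> contains_subgraph G H0"
    using three_colourable_or_contains[OF assms] by linarith
qed

end
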